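(* Let $h\in(0,1)$ and consider the mesh subdividing $(-1,1)$ into the four intervals $(-1,-h)$, $(-h,0)$, $(0,h)$ and $(h,1)$. For $1\le q<\infty$, consider the $L^q$-best approximation of $u(x)=\mathrm{sgn}(x)$ on $(-1,1)$ by a continuous piecewise linear function $u_h$ on this mesh such that $-u_h(-1)=u_h(1)=1$. It is characterised as follows. 1. If $h\le 0.5$, then for any $\beta\in[-1,1]$ there exists an $L^1$-best approximation $u_h$ with $u_h(0)=\beta$ and $-u_h(-h)=u_h(h)=1$. Conversely, any $L^1$-best approximation satisfies $-u_h(-h)=u_h(h)=1$ and $u_h(0)\in[-1,1]$. 2. If $h>0.5$, then for any $\beta\in[-1,1]$ the function $u_h$ with $$u_h(-h)=-\sqrt{2h}-\beta(\sqrt{2h}-1),\qquad u_h(0)=\beta,\qquad u_h(h)=\sqrt{2h}-\beta(\sqrt{2h}-1)$$ (and $-u_h(-1)=u_h(1)=1$) is an $L^1$-best approximation. Conversely, any $L^1$-best approximation satisfies $u_h(0)\in[-1,1]$, $u_h(-h)=-\sqrt{2h}-\beta(\sqrt{2h}-1)$ and $u_h(h)=\sqrt{2h}-\beta(\sqrt{2h}-1)$ with $\beta=u_h(0)$. 3. For $1<q<\infty$ the unique $L^q$-best approximation is given by $-u_h(-h)=u_h(h)=\alpha$ and $u_h(0)=0$, where $\alpha>1$ and $\alpha$ satisfies $$0=-(1-h)\alpha^2q(\alpha-1)^{q-1}-h(\alpha q+1)(\alpha-1)^q+h.$$ 4. For any $h\in(0,1)$, in the limit $q\to1$ (with $q>1$)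 the $L^q$-best approximation converges to the $L^1$-best approximation with $u_h(0)=0$. This $L^1$-best approximation is anti-symmetric (odd) and satisfies $-u_h(-h)=u_h(h)=1$ if $h\le0.5$, and $-u_h(-h)=u_h(h)=\sqrt{2h}$ if $h>0.5$.
   Context: Here $\mathrm{sgn}(x)$ equals $-1$ for $x<0$, $1$ for $x>0$ and $0$ for $x=0$. Let $V$ be the set of continuous functions $v_h$ on $[-1,1]$ that are affine on each of the four mesh intervals and satisfy $v_h(-1)=-1$ and $v_h(1)=1$. An $L^q$-best approximation of $u$ is a function $u_h\in V$ such that $\|u-u_h\|_{L^q((-1,1))}\le\|u-v_h\|_{L^q((-1,1))}$ for all $v_h\in V$. An element of $V$ is determined by its values at $-h$, $0$, $h$; convergence is convergence of these nodal values (equivalently, in any norm on the finite-dimensional space of continuous piecewise linear functions on the mesh). *)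

theory Defs
  imports "HOL-Analysis.Analysis"
begin

definition mesh :: "real \<Rightarrow> real set set" where
  "mesh h = {{-1<..<-h}, {-h<..<0}, {0<..<h}, {h<..<1}}"

(* A function on [-1,1] is represented by an extensional function, so that
   equality of elements is equality on [-1,1]. *)
definition V :: "real \<Rightarrow> (real \<Rightarrow> real) set" where
  "V h = {v \<in> extensional {-1..1}. continuous_on {-1..1} v
            \<and> (\<forall>I\<in>mesh h. \<exists>a b. \<forall>x\<in>I. v x = a * x + b)
            \<and> v (-1) = -1 \<and> v 1 = 1}"

(* Only applied below to bounded Borel functions with q \<ge> 1, where the integral
   is finite. *)
definition Lq_norm :: "real \<Rightarrow> (real \<Rightarrow> real) \<Rightarrow> real" where
  "Lq_norm q f = (LINT x:{-1<..<1}|lborel. \<bar>f x\<bar> powr q) powr (1 / q)"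

definition Lq_best :: "real \<Rightarrow> real \<Rightarrow> (real \<Rightarrow> real) \<Rightarrow> (real \<Rightarrow> real) \<Rightarrow> bool" where
  "Lq_best q h u v \<longleftrightarrow> v \<in> V h \<and>
     (\<forall>w\<in>V h. Lq_norm q (\<lambda>x. u x - v x) \<le> Lq_norm q (\<lambda>x. u x - w x))"

(* Well defined for 0 < h < 1 by V_nodal_ex1 below. *)
definition nodal_fun :: "real \<Rightarrow> real \<Rightarrow> real \<Rightarrow> real \<Rightarrow> real \<Rightarrow> real" where
  "nodal_fun h a b c = (THE v. v \<in> V h \<and> v (-h) = a \<and> v 0 = b \<and> v h = c)"

lemma affine_on_closure:
  fixes v :: "real \<Rightarrow> real"
  assumes "continuous_on {-1..1} v" "-1 \<le> l" "l < r" "r \<le> 1"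
    and "\<forall>x\<in>{l<..<r}. v x = a * x + b" and x: "x \<in> {l..r}"
  shows "v x = a * x + b"
proof (rule continuous_constant_on_closure[of "{l<..<r}" "\<lambda>x. v x - (a * x + b)" 0 x, simplified])
  have "closure {l<..<r} = {l..r}" using assms(3) by simp
  then show "continuous_on (closure {l<..<r}) (\<lambda>x. v x - (a * x + b))"
    using assms(2-4) by (auto intro!: continuous_intros continuous_on_subset[OF assms(1)])
qed (use assms in auto)

lemma affine_eq:
  fixes v w :: "real \<Rightarrow> real"
  assumes "continuous_on {-1..1} v" "continuous_on {-1..1} w" "-1 \<le> l" "l < r" "r \<le> 1"
    and "\<exists>a b. \<forall>x\<in>{l<..<r}. v x = a * x + b" "\<exists>a b. \<forall>x\<in>{l<..<r}. w x = a * x + b"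
    and "v l = w l" "v r = w r" and x: "x \<in> {l..r}"
  shows "v x = w x"
proof -
  obtain a b a' b' where *: "\<forall>x\<in>{l<..<r}. v x = a * x + b" "\<forall>x\<in>{l<..<r}. w x = a' * x + b'"
    using assms by blast
  have v: "v y = a * y + b" and w: "w y = a' * y + b'" if "y \<in> {l..r}" for y
    using affine_on_closure[OF assms(1,3-5) *(1) that] affine_on_closure[OF assms(2-5) *(2) that] by auto
  have 1: "a * l + b = a' * l + b'" "a * r + b = a' * r + b'"
    using v[of l] w[of l] v[of r] w[of r] assms by auto
  then have "(a - a') * (r - l) = 0" by (simp add: algebra_simps)
  with \<open>l < r\<close> have "a = a'" by simp
  with 1 show ?thesis using v[OF x] w[OF x] by simp
qed

lemma V_nodal_unique:
  assumes h: "0 < h" "h < 1" and "v \<in> V h" "w \<in> V h"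
    and "v (-h) = w (-h)" "v 0 = w 0" "v h = w h"
  shows "v = w"
proof (rule extensionalityI[of _ "{-1..1}"])
  fix x :: real assume x: "x \<in> {-1..1}"
  have v: "continuous_on {-1..1} v" "v (-1) = -1" "v 1 = 1"
    "\<And>I. I \<in> mesh h \<Longrightarrow> \<exists>a b. \<forall>x\<in>I. v x = a * x + b"
    using assms(3) by (auto simp: V_def)
  have w: "continuous_on {-1..1} w" "w (-1) = -1" "w 1 = 1"
    "\<And>I. I \<in> mesh h \<Longrightarrow> \<exists>a b. \<forall>x\<in>I. w x = a * x + b"
    using assms(4) by (auto simp: V_def)
  have eq: "v x = w x" if "{l<..<r} \<in> mesh h" "-1 \<le> l" "l < r" "r \<le> 1" "v l = w l" "v r = w r"
    "x \<in> {l..r}" for l r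
    using affine_eq[OF v(1) w(1) that(2-4) v(4)[OF that(1)] w(4)[OF that(1)] that(5-7)] .
  consider "x \<in> {-1..-h}" | "x \<in> {-h..0}" | "x \<in> {0..h}" | "x \<in> {h..1}" using x by fastforce
  then show "v x = w x"
  proof cases
    case 1 then show ?thesis using h v(2) w(2) assms(5) by (intro eq[of "-1" "-h"]) (auto simp: mesh_def)
  next
    case 2 then show ?thesis using h assms(5,6) by (intro eq[of "-h" 0]) (auto simp: mesh_def)
  next
    case 3 then show ?thesis using h assms(6,7) by (intro eq[of 0 h]) (auto simp: mesh_def)
  next
    case 4 then show ?thesis using h v(3) w(3) assms(7) by (intro eq[of h 1]) (auto simp: mesh_def)
  qed
qed (use assms in \<open>auto simp: V_def\<close>)

lemma V_nodal_ex1: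
  assumes h: "0 < h" "h < 1"
  shows "\<exists>!v. v \<in> V h \<and> v (-h) = a \<and> v 0 = b \<and> v h = c"
proof (rule ex_ex1I)
  define L :: "real \<Rightarrow> real \<Rightarrow> real \<Rightarrow> real \<Rightarrow> real \<Rightarrow> real"
    where "L l r p s x = (s - p) / (r - l) * x + (p - (s - p) / (r - l) * l)" for l r p s x
  have Ll: "L l r p s l = p" for l r p s by (simp add: L_def)
  have Lr: "L l r p s r = s" if "l < r" for l r p s
  proof -
    have "L l r p s r = (s - p) / (r - l) * (r - l) + p" by (simp only: L_def right_diff_distrib)
    with that show ?thesis by simp
  qed
  have Lc: "continuous_on A (L l r p s)" for A l r p s
    unfolding L_def by (intro continuous_intros)
  define g where "g x = (if x \<le> 0 then (if x \<le> -h then L (-1) (-h) (-1) a x else L (-h) 0 a b x)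
    else (if x \<le> h then L 0 h b c x else L h 1 c 1 x))" for x
  have c1: "continuous_on {..0} (\<lambda>x. if x \<le> -h then L (-1) (-h) (-1) a x else L (-h) 0 a b x)"
    by (rule continuous_on_subset[of UNIV])
       (use continuous_on_cases_le[OF Lc Lc, of "UNIV::real set" "\<lambda>x. x" "-h" "-1" "-h" "-1" a "-h" 0 a b] h
         in \<open>auto simp: Ll Lr\<close>)
  have c2: "continuous_on {0..} (\<lambda>x. if x \<le> h then L 0 h b c x else L h 1 c 1 x)"
    by (rule continuous_on_subset[of UNIV])
       (use continuous_on_cases_le[OF Lc Lc, of "UNIV::real set" "\<lambda>x. x" "h" 0 h b c h 1 c 1] h
         in \<open>auto simp: Ll Lr\<close>)
  have "continuous_on UNIV g"
    unfolding g_def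
    by (rule continuous_on_cases_le)
       (use c1 c2 h in \<open>auto simp: Ll Lr atMost_def atLeast_def\<close>)
  then have c: "continuous_on {-1..1} g" by (rule continuous_on_subset) simp
  have aff: "\<exists>a b. \<forall>x\<in>I. g x = a * x + b" if "\<forall>x\<in>I. g x = L l r p s x" for I l r p s
    using that unfolding L_def by blast
  have "restrict g {-1..1} \<in> V h"
    unfolding V_def mesh_def
  proof (safe, goal_cases)
    case 2
    show ?case using c by (subst continuous_on_cong[OF refl, of _ _ g]) auto
  next
    case 3
    have "\<forall>x\<in>{-1<..<-h}. g x = L (-1) (-h) (-1) a x" using h by (auto simp: g_def)
    from aff[OF this] show ?case using h by auto
  next
    case 4
    have "\<forall>x\<in>{-h<..<0}. g x = L (-h) 0 a b x" using h by (auto simp: g_def)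
    from aff[OF this] show ?case using h by auto
  next
    case 5
    have "\<forall>x\<in>{0<..<h}. g x = L 0 h b c x" using h by (auto simp: g_def)
    from aff[OF this] show ?case using h by auto
  next
    case 6
    have "\<forall>x\<in>{h<..<1}. g x = L h 1 c 1 x" using h by (auto simp: g_def)
    from aff[OF this] show ?case using h by auto
  qed (use h in \<open>auto simp: g_def Ll Lr\<close>)
  then show "\<exists>v. v \<in> V h \<and> v (-h) = a \<and> v 0 = b \<and> v h = c"
    using h by (intro exI[of _ "restrict g {-1..1}"]) (auto simp: g_def Ll Lr)
qed (use V_nodal_unique[OF h] in auto)

lemma nodal_fun:
  assumes "0 < h" "h < 1"
  shows "nodal_fun h a b c \<in> V h" "nodal_fun h a b c (-h) = a"
    "nodal_fun h a b c 0 = b" "nodal_fun h a b c h = c"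
  using theI'[OF V_nodal_ex1[OF assms, of a b c]] by (simp_all add: nodal_fun_def)

end

theory Submission
  imports Defs
begin

text \<open>
  The error \<open>sgn - v\<close> of \<open>v \<in> V h\<close> is affine on each mesh interval and vanishes at \<open>-1\<close> and \<open>1\<close>.
  On the right half it has the one-sided nodal values \<open>B = 1 - v 0\<close> and \<open>C = 1 - v h\<close>, and on the
  left half, up to sign, \<open>1 + v 0\<close> and \<open>1 + v (-h)\<close>. Integrating the \<open>q\<close>-th power of its modulus
  explicitly writes \<open>q + 1\<close> times the error integral as
  \<open>W (1 - v 0) (1 - v h) + W (1 + v 0) (1 + v (-h))\<close> with one function \<open>W\<close>, called
  \<open>half_error h q\<close> below (lemma \<open>Lq_norm_sgn_minus\<close>).

  The key point is that \<open>W\<close> is homogeneous of degree \<open>q\<close>. Hence the optimal outer value \<open>C\<close> for a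
  given \<open>B\<close> is proportional to \<open>B\<close>: if the profile \<open>t \<mapsto> W 1 (-t)\<close> attains its strict minimum
  \<open>m\<close> at \<open>s\<close>, then \<open>W B C \<ge> m \<bar>B\<bar>\<^sup>q\<close> with equality exactly for \<open>C = - s B\<close>
  (lemma \<open>half_error_lower_bound\<close>). With \<open>b = v 0\<close>, what remains is to minimise
  \<open>\<bar>1 - b\<bar>\<^sup>q + \<bar>1 + b\<bar>\<^sup>q\<close>. Its minimum is \<open>2\<close>, attained on all of \<open>[-1, 1]\<close> if \<open>q = 1\<close> and only at \<open>0\<close>
  if \<open>q > 1\<close>. This treats all \<open>q \<ge> 1\<close> at once and proves existence and
  characterisation together (theorem \<open>Lq_best_sgn_iff\<close>).

  The derivative of the profile at \<open>t > 0\<close> has the sign of a function \<open>critical h q\<close> that is strictly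
  increasing in \<open>t\<close>. Its zero, shifted by the substitution \<open>\<alpha> = 1 + t\<close>, is the root in the
  characterisation for \<open>q > 1\<close>. For \<open>q = 1\<close> it is \<open>(1 + t)\<^sup>2 - 2 h\<close>, which is positive
  for all \<open>t > 0\<close> if \<open>h \<le> 1/2\<close> and has the zero \<open>sqrt (2 h) - 1\<close> otherwise. Since
  \<open>critical h q t\<close> is continuous in \<open>q\<close> for fixed \<open>t > 0\<close>, its monotonicity in \<open>t\<close> makes the roots
  converge as \<open>q\<close> decreases to \<open>1\<close> (lemma \<open>critical_root_tendsto\<close>).
\<close>

section \<open>The error integral in terms of nodal values\<close>

text \<open>
  The mean of \<open>\<bar>y\<bar>\<^sup>q\<close> over the segment from \<open>p\<close> to \<open>s\<close>, multiplied by \<open>q + 1\<close>: a difference quotient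
  of \<open>y \<bar>y\<bar>\<^sup>q\<close>, whose derivative is \<open>(q + 1) \<bar>y\<bar>\<^sup>q\<close> on the whole real line.
\<close>

definition segment_moment :: "real \<Rightarrow> real \<Rightarrow> real \<Rightarrow> real" where
  "segment_moment q p s = (if p = s then (q + 1) * \<bar>p\<bar> powr q
     else (s * \<bar>s\<bar> powr q - p * \<bar>p\<bar> powr q) / (s - p))"

text \<open>
  The normalised error on one half of the domain. The last interval contributes
  \<open>(1 - h) \<bar>C\<bar>\<^sup>q\<close> because the error falls linearly from \<open>C\<close> to \<open>0\<close> there.
\<close>

definition half_error :: "real \<Rightarrow> real \<Rightarrow> real \<Rightarrow> real \<Rightarrow> real" where
  "half_error h q B C = h * segment_moment q B C + (1 - h) * \<bar>C\<bar> powr q"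

lemma segment_moment_commute: "segment_moment q p s = segment_moment q s p"
  unfolding segment_moment_def
  using minus_divide_divide[of "s * \<bar>s\<bar> powr q - p * \<bar>p\<bar> powr q" "s - p"] by auto

lemma segment_moment_minus: "segment_moment q (-p) (-s) = segment_moment q p s"
  unfolding segment_moment_def
  using minus_divide_divide[of "s * \<bar>s\<bar> powr q - p * \<bar>p\<bar> powr q" "s - p"] by auto

lemma segment_moment_0: "q > 0 \<Longrightarrow> segment_moment q p 0 = \<bar>p\<bar> powr q"
  by (auto simp: segment_moment_def)

lemma segment_moment_scale:
  "c \<noteq> 0 \<Longrightarrow> segment_moment q (c * p) (c * s) = \<bar>c\<bar> powr q * segment_moment q p s"
proof (cases "p = s")
  case False
  assume c: "c \<noteq> 0"
  have "c * s * \<bar>c * s\<bar> powr q - c * p * \<bar>c * p\<bar> powr q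
      = c * (\<bar>c\<bar> powr q * (s * \<bar>s\<bar> powr q - p * \<bar>p\<bar> powr q))"
    by (simp add: abs_mult powr_mult algebra_simps)
  then show ?thesis
    using c False by (simp add: segment_moment_def flip: right_diff_distrib)
qed (simp add: segment_moment_def abs_mult powr_mult)

lemma DERIV_signed_power:
  fixes q y :: real
  assumes "q > 0"
  shows "((\<lambda>y. y * \<bar>y\<bar> powr q) has_real_derivative (q + 1) * \<bar>y\<bar> powr q) (at y)"
proof -
  consider "y > 0" | "y < 0" | "y = 0" by linarith
  then show ?thesis
  proof cases
    case 1
    have "((\<lambda>y. y * y powr q) has_real_derivative (q + 1) * y powr q) (at y)"
      using 1 by (auto intro!: derivative_eq_intros simp: field_simps powr_diff)
    from has_field_derivative_transform_within_open[OF this, of "{0<..}"] 1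
    show ?thesis by auto
  next
    case 2
    have "((\<lambda>y. y * (-y) powr q) has_real_derivative (q + 1) * (-y) powr q) (at y)"
      using 2 by (auto intro!: derivative_eq_intros simp: field_simps powr_diff)
    from has_field_derivative_transform_within_open[OF this, of "{..<0}"] 2
    show ?thesis by auto
  next
    case 3
    have "((\<lambda>x::real. \<bar>x\<bar> powr q) \<longlongrightarrow> \<bar>0\<bar> powr q) (at 0)"
      using assms by (intro tendsto_powr' tendsto_intros) auto
    then have "((\<lambda>x::real. x * \<bar>x\<bar> powr q / x) \<longlongrightarrow> 0) (at 0)"
      by (rule Lim_transform_eventually[rotated, rotated, THEN tendsto_eq_rhs])
         (auto simp: eventually_at_filter)
    then show ?thesis using 3 by (simp add: DERIV_def)
  qed
qed

text \<open>
  For \<open>k \<noteq> 0\<close> the function \<open>(k x + d) \<bar>k x + d\<bar>\<^sup>q / ((q + 1) k)\<close> is an antiderivative even across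
  the zero of \<open>k x + d\<close>, so errors that change sign within an interval are covered.
\<close>

lemma integral_affine_abs_powr:
  fixes q k d l r :: real
  assumes "q > 0" "l < r"
  shows "has_bochner_integral lborel (\<lambda>x. \<bar>k * x + d\<bar> powr q * indicator {l..r} x)
    ((r - l) / (q + 1) * segment_moment q (k * l + d) (k * r + d))"
proof -
  have cont: "isCont (\<lambda>x. \<bar>k * x + d\<bar> powr q) x" for x
    using assms unfolding isCont_def by (intro tendsto_powr' tendsto_intros) auto
  show ?thesis
  proof (cases "k = 0")
    case True
    have "has_bochner_integral lborel (\<lambda>x. \<bar>k * x + d\<bar> powr q * indicator {l..r} x)
       (r * \<bar>d\<bar> powr q - l * \<bar>d\<bar> powr q)"
      using assms True
      by (intro has_bochner_integral_FTC_Icc_real cont) (auto intro!: derivative_eq_intros)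
    moreover have "r * \<bar>d\<bar> powr q - l * \<bar>d\<bar> powr q
        = (r - l) / (q + 1) * segment_moment q (k * l + d) (k * r + d)"
      using True assms by (simp add: segment_moment_def flip: left_diff_distrib)
    ultimately show ?thesis by simp
  next
    case False
    define F where "F x = (k * x + d) * \<bar>k * x + d\<bar> powr q / ((q + 1) * k)" for x
    have "DERIV F x :> \<bar>k * x + d\<bar> powr q" for x
    proof -
      have "((\<lambda>x. k * x + d) has_real_derivative k) (at x)"
        by (auto intro!: derivative_eq_intros)
      from DERIV_cdivide[OF DERIV_chain2[OF DERIV_signed_power[OF assms(1)] this],
          of "(q + 1) * k"]
      show ?thesis using False assms by (simp add: F_def[abs_def])
    qed
    then have "has_bochner_integral lborel (\<lambda>x. \<bar>k * x + d\<bar> powr q * indicator {l..r} x)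
       (F r - F l)"
      using assms by (intro has_bochner_integral_FTC_Icc_real cont) auto
    moreover have "F r - F l = (r - l) / (q + 1) * segment_moment q (k * l + d) (k * r + d)"
    proof -
      have "k * l + d \<noteq> k * r + d" "k * r + d - (k * l + d) = k * (r - l)"
        using False assms by (auto simp: algebra_simps)
      then show ?thesis
        using assms by (simp add: F_def segment_moment_def flip: diff_divide_distrib)
    qed
    ultimately show ?thesis by simp
  qed
qed

lemma Lq_norm_sgn_minus:
  assumes h: "0 < h" "h < 1" and q: "q > 0" and v: "v \<in> V h"
  shows "Lq_norm q (\<lambda>x. sgn x - v x) = ((half_error h q (1 - v 0) (1 - v h)
      + half_error h q (1 + v 0) (1 + v (-h))) / (q + 1)) powr (1 / q)"
proof -
  have c: "continuous_on {-1..1} v" and v1: "v (-1) = -1" "v 1 = 1"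
    and aff: "\<And>I. I \<in> mesh h \<Longrightarrow> \<exists>a b. \<forall>x\<in>I. v x = a * x + b"
    using v by (auto simp: V_def)
  define piece where "piece d k l r x = \<bar>k * x + d\<bar> powr q * indicator {l..r} x"
    for d k l r x :: real
  have main: "\<exists>k d. (\<forall>x\<in>{l..r}. e - v x = k * x + d) \<and>
      has_bochner_integral lborel (piece d k l r)
        ((r - l) / (q + 1) * segment_moment q (e - v l) (e - v r))"
    if lr: "{l<..<r} \<in> mesh h" "-1 \<le> l" "l < r" "r \<le> 1" for e l r
  proof -
    obtain a b where "\<forall>x\<in>{l<..<r}. v x = a * x + b" using aff[OF lr(1)] by blast
    note ab = affine_on_closure[OF c lr(2-4) this]
    have diff: "e - v x = (-a) * x + (e - b)" if "x \<in> {l..r}" for x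
      using ab[OF that] by simp
    show ?thesis
    proof (intro exI conjI)
      show "\<forall>x\<in>{l..r}. e - v x = (-a) * x + (e - b)" using diff by blast
      show "has_bochner_integral lborel (piece (e - b) (-a) l r)
          ((r - l) / (q + 1) * segment_moment q (e - v l) (e - v r))"
        using integral_affine_abs_powr[OF q \<open>l < r\<close>, of "-a" "e - b"] \<open>l < r\<close>
        unfolding piece_def by (simp add: diff)
    qed
  qed
  have mesh: "{-1<..<-h} \<in> mesh h" "{-h<..<0} \<in> mesh h" "{0<..<h} \<in> mesh h"
    "{h<..<1} \<in> mesh h"
    by (simp_all add: mesh_def)
  have le: "(-1::real) \<le> -1" "-1 \<le> -h" "-1 \<le> (0::real)" "-1 \<le> h" "-h \<le> 1" "0 \<le> (1::real)"
    "h \<le> 1" "1 \<le> (1::real)" and less: "-1 < -h" "-h < 0"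
    using h by auto
  obtain k1 d1 where 1: "\<forall>x\<in>{-1..-h}. -1 - v x = k1 * x + d1"
    "has_bochner_integral lborel (piece d1 k1 (-1) (-h))
      ((-h - -1) / (q + 1) * segment_moment q (-1 - v (-1)) (-1 - v (-h)))"
    using main[OF mesh(1) le(1) less(1) le(5)] by blast
  obtain k2 d2 where 2: "\<forall>x\<in>{-h..0}. -1 - v x = k2 * x + d2"
    "has_bochner_integral lborel (piece d2 k2 (-h) 0)
      ((0 - -h) / (q + 1) * segment_moment q (-1 - v (-h)) (-1 - v 0))"
    using main[OF mesh(2) le(2) less(2) le(6)] by blast
  obtain k3 d3 where 3: "\<forall>x\<in>{0..h}. 1 - v x = k3 * x + d3"
    "has_bochner_integral lborel (piece d3 k3 0 h)
      ((h - 0) / (q + 1) * segment_moment q (1 - v 0) (1 - v h))"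
    using main[OF mesh(3) le(3) h(1) le(7)] by blast
  obtain k4 d4 where 4: "\<forall>x\<in>{h..1}. 1 - v x = k4 * x + d4"
    "has_bochner_integral lborel (piece d4 k4 h 1)
      ((1 - h) / (q + 1) * segment_moment q (1 - v h) (1 - v 1))"
    using main[OF mesh(4) le(4) h(2) le(8)] by blast
  \<comment> \<open>The affine pieces live on closed intervals; they overlap, and miss the value \<open>sgn 0 = 0\<close>,
    only at the five mesh points, which form a null set.\<close>
  define g where "g x = piece d1 k1 (-1) (-h) x + piece d2 k2 (-h) 0 x
      + piece d3 k3 0 h x + piece d4 k4 h 1 x" for x
  have "(LINT x:{-1<..<1}|lborel. \<bar>sgn x - v x\<bar> powr q) = integral\<^sup>L lborel g"
    unfolding set_lebesgue_integral_def
  proof (rule integral_discrete_difference[where X="{-1,-h,0,h,1}"])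
    fix x :: real assume "x \<notin> {-1,-h,0,h,1}"
    then consider "x < -1" | "-1 < x" "x < -h" | "-h < x" "x < 0" | "0 < x" "x < h"
      | "h < x" "x < 1" | "1 < x"
      by fastforce
    then show "indicat_real {-1<..<1} x *\<^sub>R \<bar>sgn x - v x\<bar> powr q = g x"
    proof cases
      case 2 then show ?thesis using h 1(1) by (simp add: g_def piece_def)
    next
      case 3 then show ?thesis using h 2(1) by (simp add: g_def piece_def)
    next
      case 4 then show ?thesis using h 3(1) by (simp add: g_def piece_def)
    next
      case 5 then show ?thesis using h 4(1) by (simp add: g_def piece_def)
    qed (use h in \<open>simp_all add: g_def piece_def\<close>)
  qed auto
  also have "\<dots> = (-h - -1) / (q + 1) * segment_moment q (-1 - v (-1)) (-1 - v (-h))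
      + (0 - -h) / (q + 1) * segment_moment q (-1 - v (-h)) (-1 - v 0)
      + (h - 0) / (q + 1) * segment_moment q (1 - v 0) (1 - v h)
      + (1 - h) / (q + 1) * segment_moment q (1 - v h) (1 - v 1)"
    unfolding g_def
    by (intro has_bochner_integral_integral_eq has_bochner_integral_add 1(2) 2(2) 3(2) 4(2))
  also have "segment_moment q (-1 - v (-1)) (-1 - v (-h)) = \<bar>1 + v (-h)\<bar> powr q"
    using segment_moment_minus[of q "1 + v (-h)" 0] q
    by (simp add: v1 segment_moment_0 segment_moment_commute[of q 0])
  also have "segment_moment q (-1 - v (-h)) (-1 - v 0) = segment_moment q (1 + v 0) (1 + v (-h))"
    using segment_moment_minus[of q "1 + v (-h)" "1 + v 0"]
    by (simp add: segment_moment_commute[of q "1 + v 0"])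
  also have "segment_moment q (1 - v h) (1 - v 1) = \<bar>1 - v h\<bar> powr q"
    using q by (simp add: v1 segment_moment_0)
  also have "(-h - -1) / (q + 1) * \<bar>1 + v (-h)\<bar> powr q
      + (0 - -h) / (q + 1) * segment_moment q (1 + v 0) (1 + v (-h))
      + (h - 0) / (q + 1) * segment_moment q (1 - v 0) (1 - v h)
      + (1 - h) / (q + 1) * \<bar>1 - v h\<bar> powr q
    = (half_error h q (1 - v 0) (1 - v h) + half_error h q (1 + v 0) (1 + v (-h))) / (q + 1)"
    by (simp add: half_error_def add_divide_distrib)
  finally show ?thesis by (simp add: Lq_norm_def)
qed


section \<open>Reduction by homogeneity to one variable\<close>

text \<open>
  An outer error of the same sign as the inner one does not pay: the modulus of the affine error from
  \<open>1\<close> to \<open>t \<ge> 0\<close> dominates that of the error from \<open>1\<close> to \<open>0\<close>, whose moment is \<open>1\<close>. This discards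
  negative arguments of the profile, so that only its behaviour on \<open>[0, \<infinity>)\<close> matters.
\<close>

lemma segment_moment_ge_1:
  assumes "q \<ge> 1" "t \<ge> 0"
  shows "segment_moment q 1 t \<ge> 1"
proof (cases t "1::real" rule: linorder_cases)
  case less
  have "t * t powr q \<le> t * 1"
    using less assms by (intro mult_left_mono powr_le1) auto
  then show ?thesis using less assms by (simp add: segment_moment_def field_simps)
next
  case greater
  have "t * 1 \<le> t * t powr q"
    using greater assms by (intro mult_left_mono ge_one_powr_ge_zero) auto
  then show ?thesis using greater assms by (simp add: segment_moment_def field_simps)
qed (use assms in \<open>simp add: segment_moment_def\<close>)

lemma half_error_profile:
  assumes "t \<ge> 0"
  shows "half_error h q 1 (-t) = h * (1 + t * t powr q) / (1 + t) + (1 - h) * t powr q"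
proof -
  have "(- (t * t powr q) - 1) / (- t - 1) = (1 + t * t powr q) / (1 + t)"
    using assms by (simp add: frac_eq_eq algebra_simps)
  then show ?thesis
    using assms by (simp add: half_error_def segment_moment_def flip: times_divide_eq_right)
qed

lemma half_error_scale:
  "B \<noteq> 0 \<Longrightarrow> half_error h q B (B * t) = \<bar>B\<bar> powr q * half_error h q 1 t"
  using segment_moment_scale[of B q 1 t]
  by (simp add: half_error_def abs_mult powr_mult algebra_simps)

definition strict_minimum_at :: "(real \<Rightarrow> real) \<Rightarrow> real \<Rightarrow> bool" where
  "strict_minimum_at f s \<longleftrightarrow> 0 \<le> s \<and> (\<forall>t\<ge>0. t \<noteq> s \<longrightarrow> f s < f t)"

lemma half_error_profile_less:
  assumes h: "0 < h" "h < 1" and q: "q \<ge> 1"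
    and s: "strict_minimum_at (\<lambda>t. half_error h q 1 (-t)) s" and t: "t \<noteq> s"
  shows "half_error h q 1 (-s) < half_error h q 1 (-t)"
proof (cases "t \<ge> 0")
  case True
  then show ?thesis using s t by (simp add: strict_minimum_at_def)
next
  case False
  have "half_error h q 1 (-s) \<le> half_error h q 1 (-0)"
    using s unfolding strict_minimum_at_def by (cases "s = 0") (auto simp: less_imp_le)
  also have "\<dots> = h" using q by (simp add: half_error_def segment_moment_0)
  also have "\<dots> < h * 1 + (1 - h) * \<bar>t\<bar> powr q" using h False by simp
  also have "\<dots> \<le> half_error h q 1 (-t)"
    unfolding half_error_def
    using h False q segment_moment_ge_1[of q "-t"] by (intro add_mono mult_left_mono) auto
  finally show ?thesis .
qed

text \<open>
  By homogeneity, \<open>W B C = \<bar>B\<bar>\<^sup>q W 1 (C / B)\<close> for \<open>B \<noteq> 0\<close>, and the profile bounds the second factor.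
  For \<open>B = 0\<close> both weights combine to \<open>W 0 C = \<bar>C\<bar>\<^sup>q\<close>, which vanishes only for \<open>C = 0\<close>.
\<close>

lemma half_error_lower_bound:
  assumes h: "0 < h" "h < 1" and q: "q \<ge> 1"
    and s: "strict_minimum_at (\<lambda>t. half_error h q 1 (-t)) s"
  shows "half_error h q 1 (-s) * \<bar>B\<bar> powr q \<le> half_error h q B C"
    and "half_error h q B C = half_error h q 1 (-s) * \<bar>B\<bar> powr q \<longleftrightarrow> C = - (s * B)"
proof -
  have "half_error h q 1 (-s) * \<bar>B\<bar> powr q \<le> half_error h q B C \<and>
    (half_error h q B C = half_error h q 1 (-s) * \<bar>B\<bar> powr q \<longleftrightarrow> C = - (s * B))"
  proof (cases "B = 0")
    case True
    have "half_error h q 0 C = \<bar>C\<bar> powr q"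
      using q by (simp add: half_error_def segment_moment_0 segment_moment_commute[of q 0]
          algebra_simps)
    then show ?thesis using True q by simp
  next
    case False
    define t where "t = - C / B"
    have C: "C = B * (-t)" using False by (simp add: t_def)
    have "half_error h q B C = \<bar>B\<bar> powr q * half_error h q 1 (-t)"
      unfolding C by (rule half_error_scale[OF False])
    moreover have "C = - (s * B) \<longleftrightarrow> t = s" using False C by auto
    moreover have "half_error h q 1 (-s) < half_error h q 1 (-t)" if "t \<noteq> s"
      using half_error_profile_less[OF h q s that] .
    moreover have "\<bar>B\<bar> powr q > 0" using False by simp
    ultimately show ?thesis
      by (cases "t = s") (auto simp: mult.commute less_imp_le)
  qed
  then show "half_error h q 1 (-s) * \<bar>B\<bar> powr q \<le> half_error h q B C"
    "half_error h q B C = half_error h q 1 (-s) * \<bar>B\<bar> powr q \<longleftrightarrow> C = - (s * B)"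
    by auto
qed

lemma strict_minimum_atI:
  assumes s: "s \<ge> 0" and cont: "continuous_on {0..} f"
    and der: "\<And>x. x > 0 \<Longrightarrow> (f has_real_derivative f' x) (at x)"
    and neg: "\<And>x. 0 < x \<Longrightarrow> x < s \<Longrightarrow> f' x < 0"
    and pos: "\<And>x. s < x \<Longrightarrow> f' x > 0"
  shows "strict_minimum_at f s"
  unfolding strict_minimum_at_def
proof (intro conjI allI impI s)
  fix t :: real assume t: "t \<ge> 0" "t \<noteq> s"
  have c: "continuous_on {a..b} f" if "a \<ge> 0" for a b
    using that by (intro continuous_on_subset[OF cont]) auto
  show "f s < f t"
  proof (cases "t < s")
    case True
    then show ?thesis
      using t by (intro DERIV_neg_imp_decreasing_open[of t s f] c)
        (auto intro!: exI[of _ "f' _"] der neg)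
  next
    case False
    then show ?thesis
      using t s by (intro DERIV_pos_imp_increasing_open[of s t f] c)
        (auto intro!: exI[of _ "f' _"] der pos)
  qed
qed

lemma powr_tangent_less:
  fixes q y :: real
  assumes "q > 1" "y \<ge> 0" "y \<noteq> 1"
  shows "1 + q * (y - 1) < y powr q"
proof -
  have "strict_minimum_at (\<lambda>y. y powr q - q * (y - 1)) 1"
  proof (rule strict_minimum_atI)
    show "((\<lambda>y. y powr q - q * (y - 1)) has_real_derivative q * (x powr (q - 1) - 1)) (at x)"
      if "x > 0" for x
      using that by (auto intro!: derivative_eq_intros simp: algebra_simps)
    show "q * (x powr (q - 1) - 1) < 0" if "0 < x" "x < 1" for x
      using that assms powr_less_mono2[of "q - 1" x 1] by (simp add: mult_less_0_iff)
    show "q * (x powr (q - 1) - 1) > 0" if "1 < x" for x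
      using that assms powr_less_mono2[of "q - 1" 1 x] by simp
    show "continuous_on {0..} (\<lambda>y. y powr q - q * (y - 1))"
      using assms by (intro continuous_intros continuous_on_powr') auto
  qed simp
  then show ?thesis using assms unfolding strict_minimum_at_def by fastforce
qed

text \<open>
  The minimisers of \<open>b \<mapsto> \<bar>1 - b\<bar>\<^sup>q + \<bar>1 + b\<bar>\<^sup>q\<close> for \<open>q \<ge> 1\<close>, see \<open>sum_powr_ge_2\<close>.
\<close>

definition central_values :: "real \<Rightarrow> real set" where
  "central_values q = (if q = 1 then {-1..1} else {0})"

text \<open>
  For \<open>q > 1\<close>, add the tangent inequality at \<open>1\<close> for \<open>y = \<bar>1 - b\<bar>\<close> and \<open>y = \<bar>1 + b\<bar>\<close>, whose sum is at
  least \<open>2\<close>. It is strict for one of the two unless both equal \<open>1\<close>, that is \<open>b = 0\<close>. For \<open>q = 1\<close> the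
  sum is constant on \<open>[-1, 1]\<close>, which is why the \<open>L\<^sup>1\<close>-best approximation is not unique.
\<close>

lemma sum_powr_ge_2:
  fixes q b :: real
  assumes "q \<ge> 1"
  shows "\<bar>1 - b\<bar> powr q + \<bar>1 + b\<bar> powr q \<ge> 2"
    and "\<bar>1 - b\<bar> powr q + \<bar>1 + b\<bar> powr q = 2 \<longleftrightarrow> b \<in> central_values q"
proof -
  have "\<bar>1 - b\<bar> powr q + \<bar>1 + b\<bar> powr q \<ge> 2 \<and>
    (\<bar>1 - b\<bar> powr q + \<bar>1 + b\<bar> powr q = 2 \<longleftrightarrow> b \<in> central_values q)"
  proof (cases "q = 1")
    case False
    show ?thesis
    proof (cases "b = 0")
      case b: False
      have tangent: "1 + q * (\<bar>y\<bar> - 1) \<le> \<bar>y\<bar> powr q" for y :: real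
        using powr_tangent_less[of q "\<bar>y\<bar>"] False assms by (cases "\<bar>y\<bar> = 1") auto
      have "\<bar>1 - b\<bar> + \<bar>1 + b\<bar> \<ge> 2" by linarith
      then have *: "q * (\<bar>1 - b\<bar> + \<bar>1 + b\<bar>) \<ge> q * 2"
        using assms by (intro mult_left_mono) auto
      have "\<bar>1 - b\<bar> \<noteq> 1 \<or> \<bar>1 + b\<bar> \<noteq> 1" using b by linarith
      then have "1 + q * (\<bar>1 - b\<bar> - 1) < \<bar>1 - b\<bar> powr q \<or>
          1 + q * (\<bar>1 + b\<bar> - 1) < \<bar>1 + b\<bar> powr q"
        using powr_tangent_less[of q "\<bar>1 - b\<bar>"] powr_tangent_less[of q "\<bar>1 + b\<bar>"] False assms
        by (metis abs_ge_zero order_le_less)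
      with tangent[of "1 - b"] tangent[of "1 + b"] *
      have "\<bar>1 - b\<bar> powr q + \<bar>1 + b\<bar> powr q > 2"
        by (auto simp: algebra_simps)
      then show ?thesis using b False by (simp add: central_values_def)
    qed (use False in \<open>simp add: central_values_def\<close>)
  qed (auto simp: central_values_def)
  then show "\<bar>1 - b\<bar> powr q + \<bar>1 + b\<bar> powr q \<ge> 2"
    "\<bar>1 - b\<bar> powr q + \<bar>1 + b\<bar> powr q = 2 \<longleftrightarrow> b \<in> central_values q" by auto
qed

text \<open>
  The two halves of the error share only the value at \<open>0\<close>, so their outer values are optimised
  independently. This leaves \<open>m (\<bar>1 - b\<bar>\<^sup>q + \<bar>1 + b\<bar>\<^sup>q) \<ge> 2 m\<close> with \<open>b = v 0\<close>. The bound \<open>2 m\<close> is attained by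
  the member of \<open>V h\<close> with central value \<open>0\<close> and optimal outer values, so best approximation means
  equality in both estimates.
\<close>

theorem Lq_best_sgn_iff:
  assumes h: "0 < h" "h < 1" and q: "q \<ge> 1"
    and s: "strict_minimum_at (\<lambda>t. half_error h q 1 (-t)) s"
  shows "Lq_best q h sgn v \<longleftrightarrow> v \<in> V h \<and> v 0 \<in> central_values q \<and>
     v h = 1 + s * (1 - v 0) \<and> v (-h) = - 1 - s * (1 + v 0)"
proof -
  define m where "m = half_error h q 1 (-s)"
  define E where "E w = half_error h q (1 - w 0) (1 - w h) + half_error h q (1 + w 0) (1 + w (-h))"
    for w :: "real \<Rightarrow> real"
  have "s \<ge> 0" using s by (simp add: strict_minimum_at_def)
  then have "m > 0" unfolding m_def half_error_profile[OF \<open>s \<ge> 0\<close>]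
    using h by (intro add_pos_nonneg divide_pos_pos mult_pos_pos add_pos_nonneg) auto
  have bound: "m * (\<bar>1 - w 0\<bar> powr q + \<bar>1 + w 0\<bar> powr q) \<le> E w"
    and eq: "E w = m * (\<bar>1 - w 0\<bar> powr q + \<bar>1 + w 0\<bar> powr q) \<longleftrightarrow>
      w h = 1 + s * (1 - w 0) \<and> w (-h) = - 1 - s * (1 + w 0)" for w
    using half_error_lower_bound[OF h q s, of "1 - w 0" "1 - w h"]
      half_error_lower_bound[OF h q s, of "1 + w 0" "1 + w (-h)"]
    unfolding E_def m_def by (auto simp: algebra_simps)
  have two: "m * 2 \<le> m * (\<bar>1 - w 0\<bar> powr q + \<bar>1 + w 0\<bar> powr q)"
    and twoeq: "m * (\<bar>1 - w 0\<bar> powr q + \<bar>1 + w 0\<bar> powr q) = m * 2 \<longleftrightarrow> w 0 \<in> central_values q"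
    for w :: "real \<Rightarrow> real"
    using \<open>m > 0\<close> sum_powr_ge_2[OF q, of "w 0"] by simp_all
  have min: "m * 2 \<le> E w" for w using bound[of w] two[of w] by linarith
  have attained: "E w = m * 2 \<longleftrightarrow> w 0 \<in> central_values q \<and>
      w h = 1 + s * (1 - w 0) \<and> w (-h) = - 1 - s * (1 + w 0)" for w
    using bound[of w] eq[of w] two[of w] twoeq[of w] by auto
  have norm_le: "Lq_norm q (\<lambda>x. sgn x - v x) \<le> Lq_norm q (\<lambda>x. sgn x - w x) \<longleftrightarrow> E v \<le> E w"
    if "v \<in> V h" "w \<in> V h" for v w
  proof -
    have "E v > 0" "E w > 0" using min[of v] min[of w] \<open>m > 0\<close> by auto
    then have "0 < E v / (q + 1)" "0 < E w / (q + 1)" using q by auto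
    then have "(E v / (q + 1)) powr (1 / q) \<le> (E w / (q + 1)) powr (1 / q)
        \<longleftrightarrow> E v / (q + 1) \<le> E w / (q + 1)"
      using powr_mono2[of "1 / q" "E v / (q + 1)" "E w / (q + 1)"]
        powr_less_mono2[of "1 / q" "E w / (q + 1)" "E v / (q + 1)"] q by fastforce
    then show ?thesis
      using that q h by (simp add: Lq_norm_sgn_minus E_def[symmetric] divide_le_cancel)
  qed
  define w0 where "w0 = nodal_fun h (- 1 - s) 0 (1 + s)"
  have w0: "w0 \<in> V h" "E w0 = m * 2"
    unfolding attained using nodal_fun[OF h] by (auto simp: w0_def central_values_def)
  have "Lq_best q h sgn v \<longleftrightarrow> v \<in> V h \<and> E v = m * 2"
    unfolding Lq_best_def using norm_le w0 min by (metis order_antisym)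
  then show ?thesis unfolding attained by blast
qed


section \<open>The critical point of the profile\<close>

text \<open>
  The numerator of the derivative of the profile over the denominator \<open>(1 + t)\<^sup>2\<close>. Each of its terms
  that depend on \<open>t\<close> is, for \<open>0 < h < 1\<close> and \<open>q \<ge> 1\<close>, a product of nonnegative nondecreasing functions.
\<close>

definition critical :: "real \<Rightarrow> real \<Rightarrow> real \<Rightarrow> real" where
  "critical h q t = (1 - h) * (1 + t)\<^sup>2 * q * t powr (q - 1) + h * ((1 + t) * q + 1) * t powr q - h"

lemma DERIV_profile:
  assumes "t > 0"
  shows "((\<lambda>t. h * (1 + t * t powr q) / (1 + t) + (1 - h) * t powr q)
     has_real_derivative critical h q t / (1 + t)\<^sup>2) (at t)"
proof -
  define N where "N = h * ((q + 1) * t powr q) * (1 + t) - h * (1 + t * t powr q)"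
  have p: "t powr q + q * t powr (q - 1) * t = (q + 1) * t powr q"
    using assms by (simp add: powr_diff algebra_simps)
  have "((\<lambda>t. h * (1 + t * t powr q) / (1 + t) + (1 - h) * t powr q)
     has_real_derivative N / ((1 + t) * (1 + t)) + (1 - h) * (q * t powr (q - 1))) (at t)"
    using assms by (auto intro!: derivative_eq_intros simp: N_def p)
  moreover have "critical h q t = N + (1 - h) * (q * t powr (q - 1)) * ((1 + t) * (1 + t))"
    by (simp add: critical_def N_def power2_eq_square algebra_simps)
  ultimately show ?thesis
    using assms by (simp add: add_divide_distrib power2_eq_square)
qed

lemma strict_minimum_at_critical:
  assumes q: "q \<ge> 1" and s: "s \<ge> 0"
    and neg: "\<And>t. 0 < t \<Longrightarrow> t < s \<Longrightarrow> critical h q t < 0"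
    and pos: "\<And>t. s < t \<Longrightarrow> critical h q t > 0"
  shows "strict_minimum_at (\<lambda>t. half_error h q 1 (-t)) s"
proof -
  have "strict_minimum_at (\<lambda>t. h * (1 + t * t powr q) / (1 + t) + (1 - h) * t powr q) s"
  proof (rule strict_minimum_atI[OF s])
    show "continuous_on {0..} (\<lambda>t. h * (1 + t * t powr q) / (1 + t) + (1 - h) * t powr q)"
      using q by (intro continuous_intros continuous_on_powr') auto
    show "critical h q t / (1 + t)\<^sup>2 < 0" if "0 < t" "t < s" for t
      using neg[OF that] that by (intro divide_neg_pos) auto
    show "0 < critical h q t / (1 + t)\<^sup>2" if "s < t" for t
      using pos[OF that] that s by (intro divide_pos_pos) auto
  qed (rule DERIV_profile)
  then show ?thesis
    unfolding strict_minimum_at_def by (auto simp: half_error_profile)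
qed

lemma critical_mono:
  assumes h: "0 < h" "h < 1" and q: "q \<ge> 1" and t: "0 < t" "t < t'"
  shows "critical h q t < critical h q t'"
proof -
  have "(1 - h) * (1 + t)\<^sup>2 * q * t powr (q - 1) \<le> (1 - h) * (1 + t')\<^sup>2 * q * t' powr (q - 1)"
    using assms by (intro mult_mono powr_mono2 power_mono) auto
  moreover have "h * ((1 + t) * q + 1) * t powr q < h * ((1 + t') * q + 1) * t' powr q"
    using assms by (intro mult_strict_mono' powr_less_mono2 mult_strict_left_mono) auto
  ultimately show ?thesis by (simp add: critical_def)
qed

text \<open>
  Intermediate value theorem on \<open>[0, 1]\<close>: for \<open>q > 1\<close> the function equals \<open>- h\<close> at \<open>0\<close>, since
  \<open>t powr (q - 1)\<close> vanishes there, and it is positive at \<open>1\<close>.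
\<close>

lemma critical_root_exists:
  assumes h: "0 < h" "h < 1" and q: "q > 1"
  shows "\<exists>s>0. critical h q s = 0"
proof -
  have "critical h q 0 = - h" using q by (simp add: critical_def)
  moreover have "critical h q 1 = (1 - h) * 4 * q + h * 2 * q"
    by (simp add: critical_def algebra_simps)
  moreover have "(1 - h) * 4 * q + h * 2 * q > 0" using h q by (intro add_pos_pos mult_pos_pos) auto
  moreover have "continuous_on {0..1} (critical h q)"
    unfolding critical_def using q by (intro continuous_intros continuous_on_powr') auto
  ultimately obtain s where "0 \<le> s" "s \<le> 1" "critical h q s = 0"
    using IVT'[of "critical h q" 0 0 1] h by auto
  moreover have "s \<noteq> 0" using calculation \<open>critical h q 0 = - h\<close> h by auto
  ultimately show ?thesis by (intro exI[of _ s]) auto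
qed

lemma strict_minimum_at_root:
  assumes "0 < h" "h < 1" "q \<ge> 1" "s > 0" "critical h q s = 0"
  shows "strict_minimum_at (\<lambda>t. half_error h q 1 (-t)) s"
  using assms critical_mono[of h q _ s] critical_mono[of h q s]
  by (intro strict_minimum_at_critical) auto

text \<open>
  At \<open>q = 1\<close> the powers of \<open>t\<close> reduce to \<open>1\<close> and \<open>t\<close>, and completing the square yields
  \<open>(1 - h) (1 + t)\<^sup>2 + h (1 + t)\<^sup>2 - 2 h\<close>. Positivity of \<open>t\<close> matters because \<open>0 powr 0 = 0\<close>.
\<close>

lemma critical_1: "t > 0 \<Longrightarrow> critical h 1 t = (1 + t)\<^sup>2 - 2 * h"
  by (simp add: critical_def power2_eq_square algebra_simps)

text \<open>
  The place \<open>s\<close> where the profile for \<open>q = 1\<close> is minimal. For \<open>h \<le> 1/2\<close> the profile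
  increases from the endpoint \<open>0\<close> on, so the overshoot at \<open>h\<close> disappears.
\<close>

definition L1_slope :: "real \<Rightarrow> real" where
  "L1_slope h = (if h \<le> 1 / 2 then 0 else sqrt (2 * h) - 1)"

lemma L1_slope_nonneg: "L1_slope h \<ge> 0"
  by (simp add: L1_slope_def)

lemma critical_1_sign:
  assumes h: "h > 0"
  shows "0 < t \<Longrightarrow> t < L1_slope h \<Longrightarrow> critical h 1 t < 0"
    and "L1_slope h < t \<Longrightarrow> critical h 1 t > 0"
proof -
  show "critical h 1 t < 0" if t: "0 < t" "t < L1_slope h"
  proof -
    have "1 + t < sqrt (2 * h)" using t by (auto simp: L1_slope_def split: if_splits)
    then have "(1 + t)\<^sup>2 < (sqrt (2 * h))\<^sup>2" using t by (intro power_strict_mono) auto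
    then show ?thesis using t h by (simp add: critical_1)
  qed
  show "critical h 1 t > 0" if t: "L1_slope h < t"
  proof -
    have "t > 0" using t L1_slope_nonneg[of h] by linarith
    have "sqrt (2 * h) < 1 + t"
    proof (cases "h \<le> 1 / 2")
      case True
      then have "sqrt (2 * h) \<le> 1" by simp
      then show ?thesis using \<open>t > 0\<close> by linarith
    qed (use t in \<open>simp add: L1_slope_def\<close>)
    then have "(sqrt (2 * h))\<^sup>2 < (1 + t)\<^sup>2" using h by (intro power_strict_mono) auto
    then show ?thesis using h \<open>t > 0\<close> by (simp add: critical_1)
  qed
qed

lemma strict_minimum_at_L1_slope:
  "h > 0 \<Longrightarrow> strict_minimum_at (\<lambda>t. half_error h 1 1 (-t)) (L1_slope h)"
  by (intro strict_minimum_at_critical L1_slope_nonneg critical_1_sign) auto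

lemma critical_tendsto:
  assumes "t > 0"
  shows "((\<lambda>q. critical h q t) \<longlongrightarrow> critical h 1 t) (at_right 1)"
  unfolding critical_def using assms by (intro tendsto_intros) auto

text \<open>
  Squeezing by signs: for fixed \<open>a > 0\<close> the sign of \<open>critical h 1 a\<close> tells on which side of
  \<open>L1_slope h\<close> the number \<open>a\<close> lies. This sign persists for \<open>q\<close> near \<open>1\<close>, and by monotonicity it then
  tells on which side of the root \<open>s q\<close> the number \<open>a\<close> lies. The argument covers the case
  \<open>L1_slope h = 0\<close>, in which the roots approach the endpoint of the domain.
\<close>

lemma critical_root_tendsto:
  assumes h: "0 < h" "h < 1" and s: "\<And>q. q > 1 \<Longrightarrow> s q > 0 \<and> critical h q (s q) = 0"
  shows "(s \<longlongrightarrow> L1_slope h) (at_right 1)"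
proof (rule order_tendstoI)
  have gt: "\<forall>\<^sub>F q in at_right (1::real). q > 1" by (rule eventually_at_right_less)
  fix a
  {
    assume a: "L1_slope h < a"
    then have "a > 0" using L1_slope_nonneg[of h] by linarith
    have "\<forall>\<^sub>F q in at_right 1. critical h q a > 0"
      using order_tendstoD(1)[OF critical_tendsto[OF \<open>a > 0\<close>] critical_1_sign(2)[OF h(1) a]] .
    with gt show "\<forall>\<^sub>F q in at_right 1. s q < a"
    proof eventually_elim
      case (elim q)
      then show ?case
        using s[of q] critical_mono[of h q a "s q"] h \<open>a > 0\<close>
        by (cases "s q" a rule: linorder_cases) auto
    qed
  next
    assume a: "a < L1_slope h"
    show "\<forall>\<^sub>F q in at_right 1. a < s q"
    proof (cases "a > 0")
      case False
      from gt show ?thesis by eventually_elim (use s False in force)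
    next
      case True
      have "\<forall>\<^sub>F q in at_right 1. critical h q a < 0"
        using order_tendstoD(2)[OF critical_tendsto[OF True] critical_1_sign(1)[OF h(1) True a]] .
      with gt show ?thesis
      proof eventually_elim
        case (elim q)
        then show ?case
          using s[of q] critical_mono[of h q "s q" a] h
          by (cases "s q" a rule: linorder_cases) auto
      qed
    qed
  }
qed


section \<open>Best approximations of the sign function\<close>

text \<open>
  Point reflection maps \<open>V h\<close> to itself, and a member of \<open>V h\<close> is determined by its nodal values.
\<close>

lemma V_nodal_odd:
  assumes h: "0 < h" "h < 1" and v: "v \<in> V h" "v 0 = 0" "v (-h) = - v h"
    and x: "x \<in> {-1..1}"
  shows "v (-x) = - v x"
proof -
  define w where "w = restrict (\<lambda>x. - v (-x)) {-1..1}"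
  have aff: "\<exists>a b. \<forall>x\<in>{l<..<r}. w x = a * x + b"
    if "{-r<..<-l} \<in> mesh h" "-1 \<le> l" "r \<le> 1" for l r
  proof -
    have "\<exists>a b. \<forall>x\<in>{-r<..<-l}. v x = a * x + b"
      using v(1) that(1) unfolding V_def by blast
    then obtain a b where "\<forall>x\<in>{-r<..<-l}. v x = a * x + b" by blast
    then have "\<forall>x\<in>{l<..<r}. w x = a * x + (-b)" using that by (auto simp: w_def)
    then show ?thesis by blast
  qed
  have "continuous_on {-1..1} (\<lambda>x. - v (-x))"
    using v(1) by (auto simp: V_def intro!: continuous_intros continuous_on_compose2[of "{-1..1}" v])
  then have "continuous_on {-1..1} w"
    by (subst continuous_on_cong[OF refl, of _ _ "\<lambda>x. - v (-x)"]) (auto simp: w_def)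
  moreover have "\<forall>I\<in>mesh h. \<exists>a b. \<forall>x\<in>I. w x = a * x + b"
    using h aff[of "-h" "-1"] aff[of 0 "-h"] aff[of h 0] aff[of 1 h] aff[of "-1" "-h"]
      aff[of "-h" 0] aff[of 0 h] aff[of h 1] by (simp add: mesh_def)
  moreover have "w (-1) = -1" "w 1 = 1" using v(1) by (auto simp: w_def V_def)
  ultimately have "w \<in> V h" by (simp add: V_def w_def)
  then have "v = w" using h v by (intro V_nodal_unique[of h]) (auto simp: w_def)
  then have "v x = w x" by simp
  then show ?thesis using x by (simp add: w_def)
qed

lemma L1_best_sgn_iff:
  assumes "0 < h" "h < 1"
  shows "Lq_best 1 h sgn v \<longleftrightarrow> v \<in> V h \<and> v 0 \<in> {-1..1} \<and>
     v h = 1 + L1_slope h * (1 - v 0) \<and> v (-h) = - 1 - L1_slope h * (1 + v 0)"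
  using Lq_best_sgn_iff[OF assms _ strict_minimum_at_L1_slope] assms
  by (simp add: central_values_def)

lemma Lq_best_sgn_set:
  assumes h: "0 < h" "h < 1" and q: "q > 1" and s: "s > 0" "critical h q s = 0"
  shows "{u. Lq_best q h sgn u} = {nodal_fun h (- (1 + s)) 0 (1 + s)}"
proof -
  have min: "strict_minimum_at (\<lambda>t. half_error h q 1 (-t)) s"
    using assms by (intro strict_minimum_at_root) auto
  have *: "Lq_best q h sgn u \<longleftrightarrow> u \<in> V h \<and> u 0 = 0 \<and> u h = 1 + s \<and> u (-h) = - (1 + s)" for u
    using Lq_best_sgn_iff[OF h less_imp_le[OF q] min, of u] q
    by (simp add: central_values_def cong: conj_cong)
  show ?thesis
  proof (intro equalityI subsetI)
    fix u assume "u \<in> {u. Lq_best q h sgn u}"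
    then show "u \<in> {nodal_fun h (- (1 + s)) 0 (1 + s)}"
      using nodal_fun[OF h] by (simp add: * V_nodal_unique[OF h])
  qed (use nodal_fun[OF h] in \<open>simp add: *\<close>)
qed

theorem theorem1p4:
  fixes h :: real
  assumes "0 < h" and "h < 1"
  shows
    "(h \<le> 1 / 2 \<longrightarrow>
        (\<forall>\<beta>\<in>{-1..1}. \<exists>u. Lq_best 1 h sgn u \<and> u 0 = \<beta> \<and> - u (-h) = 1 \<and> u h = 1) \<and>
        (\<forall>u. Lq_best 1 h sgn u \<longrightarrow> - u (-h) = 1 \<and> u h = 1 \<and> u 0 \<in> {-1..1}))
   \<and> (h > 1 / 2 \<longrightarrow>
        (\<forall>\<beta>\<in>{-1..1}. Lq_best 1 h sgn
           (nodal_fun h (- sqrt (2 * h) - \<beta> * (sqrt (2 * h) - 1)) \<beta>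
                        (sqrt (2 * h) - \<beta> * (sqrt (2 * h) - 1)))) \<and>
        (\<forall>u. Lq_best 1 h sgn u \<longrightarrow>
           u 0 \<in> {-1..1} \<and>
           u (-h) = - sqrt (2 * h) - u 0 * (sqrt (2 * h) - 1) \<and>
           u h = sqrt (2 * h) - u 0 * (sqrt (2 * h) - 1)))
   \<and> (\<forall>q>1.
        let root_eq = (\<lambda>\<alpha>. 0 = - (1 - h) * \<alpha>\<^sup>2 * q * (\<alpha> - 1) powr (q - 1)
                              - h * (\<alpha> * q + 1) * (\<alpha> - 1) powr q + h)
        in (\<exists>\<alpha>>1. root_eq \<alpha>) \<and>
           (\<forall>\<alpha>>1. root_eq \<alpha> \<longrightarrow> {u. Lq_best q h sgn u} = {nodal_fun h (-\<alpha>) 0 \<alpha>}))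
   \<and> (\<exists>u. {v. Lq_best 1 h sgn v \<and> v 0 = 0} = {u} \<and>
        (\<forall>U. (\<forall>q>1. Lq_best q h sgn (U q)) \<longrightarrow>
           (\<forall>z\<in>{-h, 0, h}. ((\<lambda>q. U q z) \<longlongrightarrow> u z) (at_right 1))) \<and>
        (\<forall>x\<in>{-1..1}. u (-x) = - u x) \<and>
        (h \<le> 1 / 2 \<longrightarrow> - u (-h) = 1 \<and> u h = 1) \<and>
        (h > 1 / 2 \<longrightarrow> - u (-h) = sqrt (2 * h) \<and> u h = sqrt (2 * h)))"
    (is "?P1 \<and> ?P2 \<and> ?P3 \<and> ?P4")
proof (intro conjI)
  note h = assms
  note nf = nodal_fun[OF h]
  note L1 = L1_best_sgn_iff[OF h]
  show ?P1
  proof (intro impI conjI ballI)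
    fix \<beta> :: real assume "h \<le> 1 / 2" "\<beta> \<in> {-1..1}"
    then show "\<exists>u. Lq_best 1 h sgn u \<and> u 0 = \<beta> \<and> - u (-h) = 1 \<and> u h = 1"
      using nf by (intro exI[of _ "nodal_fun h (-1) \<beta> 1"]) (simp add: L1 L1_slope_def)
  qed (auto simp: L1 L1_slope_def)
  show ?P2
    using nf by (auto simp: L1 L1_slope_def algebra_simps)
  have root_eq: "0 = - (1 - h) * \<alpha>\<^sup>2 * q * (\<alpha> - 1) powr (q - 1)
        - h * (\<alpha> * q + 1) * (\<alpha> - 1) powr q + h \<longleftrightarrow> critical h q (\<alpha> - 1) = 0" for \<alpha> q
    by (auto simp: critical_def algebra_simps)
  show ?P3
    unfolding Let_def root_eq
  proof (intro allI impI conjI)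
    fix q :: real assume q: "q > 1"
    obtain s where "s > 0" "critical h q s = 0" using critical_root_exists[OF h q] by blast
    then show "\<exists>\<alpha>>1. critical h q (\<alpha> - 1) = 0" by (intro exI[of _ "1 + s"]) simp
    show "{u. Lq_best q h sgn u} = {nodal_fun h (-\<alpha>) 0 \<alpha>}"
      if "\<alpha> > 1" "critical h q (\<alpha> - 1) = 0" for \<alpha>
      using Lq_best_sgn_set[OF h q, of "\<alpha> - 1"] that by simp
  qed
  show ?P4
  proof (intro exI conjI)
    define u where "u = nodal_fun h (- (1 + L1_slope h)) 0 (1 + L1_slope h)"
    have u: "u \<in> V h" "u (-h) = - (1 + L1_slope h)" "u 0 = 0" "u h = 1 + L1_slope h"
      unfolding u_def by (rule nf)+
    show "{v. Lq_best 1 h sgn v \<and> v 0 = 0} = {u}"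
      using u by (auto simp: L1 intro!: V_nodal_unique[OF h])
    show "\<forall>U. (\<forall>q>1. Lq_best q h sgn (U q)) \<longrightarrow>
           (\<forall>z\<in>{-h, 0, h}. ((\<lambda>q. U q z) \<longlongrightarrow> u z) (at_right 1))"
    proof (intro allI impI ballI)
      fix U z assume U: "\<forall>q>1. Lq_best q h sgn (U q)" and z: "z \<in> {-h, 0, h}"
      obtain s where s: "\<And>q. q > 1 \<Longrightarrow> s q > 0 \<and> critical h q (s q) = 0"
        using critical_root_exists[OF h] by metis
      have lim: "(s \<longlongrightarrow> L1_slope h) (at_right 1)" by (rule critical_root_tendsto[OF h s])
      define W where "W q = nodal_fun h (- (1 + s q)) 0 (1 + s q)" for q
      have "U q = W q" if "q > 1" for q
        using Lq_best_sgn_set[OF h that, of "s q"] s[OF that] U that by (auto simp: W_def)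
      then have "\<forall>\<^sub>F q in at_right 1. W q z = U q z"
        using eventually_at_right_less[of "1::real"] by (auto elim: eventually_mono)
      moreover have "((\<lambda>q. W q z) \<longlongrightarrow> u z) (at_right 1)"
        using z u nf by (auto simp: W_def intro!: tendsto_intros lim)
      ultimately show "((\<lambda>q. U q z) \<longlongrightarrow> u z) (at_right 1)"
        by (rule Lim_transform_eventually[rotated])
    qed
    show "\<forall>x\<in>{-1..1}. u (-x) = - u x" using V_nodal_odd[OF h u(1)] u by simp
    show "h \<le> 1 / 2 \<longrightarrow> - u (-h) = 1 \<and> u h = 1"
      and "h > 1 / 2 \<longrightarrow> - u (-h) = sqrt (2 * h) \<and> u h = sqrt (2 * h)"
      using u by (auto simp: L1_slope_def)
  qed
qed

end
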